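(* Let $G$ be an inverse semigroup. Then the following assertions are equivalent: (i) every partial homomorphism of $G$ (into any semigroup) is a homomorphism; (ii) the canonical map $\iota_G\colon g\mapsto[g]$ from $G$ into $\mathbf{Pr}(G)$ is a homomorphism; (iii) $\{[g]:g\in G\}$ is an inverse subsemigroup of $\mathbf{Pr}(G)$ (and hence equals $\mathbf{Pr}(G)$); (iv) the canonical map $\iota_G\colon G\to\mathbf{Pr}(G)$ is an isomorphism (whose inverse is the degree map $\partial\colon\mathbf{Pr}(G)\to G$); (v) $G=E(G)$, that is, $G$ is a semilattice. In particular, every inverse semigroup $G$ which is not a semilattice has a partial homomorphism which is not a homomorphism. Moreover, in this case (when $G$ is not a semilattice) one has a strictly increasing chain of inclusions given by the canonical maps: $$G\hookrightarrow\mathbf{Pr}(G)\hookrightarrow\mathbf{Pr}(\mathbf{Pr}(G))\hookrightarrow\cdots$$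
   Context: For an inverse semigroup $G$, $s^*$ denotes the inverse of $s\in G$ and $E(G)$ the set of idempotents. A map $\pi$ from $G$ to a semigroup $H$ is a partial homomorphism if for all $s,t\in G$: $\pi(s)\pi(t)\pi(t^* )=\pi(st)\pi(t^* )$, $\pi(s^* )\pi(s)\pi(t)=\pi(s^* )\pi(st)$, and $\pi(s)\pi(s^* )\pi(s)=\pi(s)$. $\mathbf{Pr}(G)$ is the universal semigroup with one generator $[s]$ for each $s\in G$ and, for all $s,t\in G$, the relations (i) $[s][t][t^*]=[st][t^*]$; (ii) $[s^*][s][t]=[s^*][st]$; (iii) $[s][s^*][s]=[s]$. It is an inverse semigroup. The canonical map $\iota_G\colon G\to\mathbf{Pr}(G)$, $g\mapsto[g]$, is a partial homomorphism; it is injective, and is what the hooked arrows denote (with $G$ replaced by $\mathbf{Pr}(G)$, $\mathbf{Pr}(\mathbf{Pr}(G))$, etc. in the later terms). The degree map $\partial\colon\mathbf{Pr}(G)\to G$ is the homomorphism with $\partial([g])=g$ for all $g\in G$. *)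

theory Defs
  imports "HOL-Algebra.Weak_Morphisms"
begin

text \<open>Semigroups are carried by the record type \<open>monoid\<close>, whose field \<open>one\<close> plays no role and is
  never constrained; \<^const>\<open>hom\<close> and \<^const>\<open>iso\<close> only mention carrier and multiplication.
  As with carrier-based structures in general, the empty carrier is not excluded.\<close>

locale sgrp =
  fixes G (structure)
  assumes m_closed: "\<lbrakk>x \<in> carrier G; y \<in> carrier G\<rbrakk> \<Longrightarrow> x \<otimes> y \<in> carrier G"
    and m_assoc: "\<lbrakk>x \<in> carrier G; y \<in> carrier G; z \<in> carrier G\<rbrakk> \<Longrightarrow> (x \<otimes> y) \<otimes> z = x \<otimes> (y \<otimes> z)"

locale inverse_sgrp = sgrp +
  assumes unique_inverse:
    "s \<in> carrier G \<Longrightarrow> \<exists>!t. t \<in> carrier G \<and> s \<otimes> t \<otimes> s = s \<and> t \<otimes> s \<otimes> t = t"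

locale semilattice_sgrp = sgrp +
  assumes m_comm: "\<lbrakk>x \<in> carrier G; y \<in> carrier G\<rbrakk> \<Longrightarrow> x \<otimes> y = y \<otimes> x"
    and m_idem: "x \<in> carrier G \<Longrightarrow> x \<otimes> x = x"

definition star :: "('a, 'm) monoid_scheme \<Rightarrow> 'a \<Rightarrow> 'a" where
  "star G s = (THE t. t \<in> carrier G \<and> s \<otimes>\<^bsub>G\<^esub> t \<otimes>\<^bsub>G\<^esub> s = s \<and> t \<otimes>\<^bsub>G\<^esub> s \<otimes>\<^bsub>G\<^esub> t = t)"

definition idempotents :: "('a, 'm) monoid_scheme \<Rightarrow> 'a set" where
  "idempotents G = {e \<in> carrier G. e \<otimes>\<^bsub>G\<^esub> e = e}"

definition inverse_subsemigroup :: "'a set \<Rightarrow> ('a, 'm) monoid_scheme \<Rightarrow> bool" where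
  "inverse_subsemigroup H G \<longleftrightarrow>
     H \<subseteq> carrier G \<and> (\<forall>x\<in>H. \<forall>y\<in>H. x \<otimes>\<^bsub>G\<^esub> y \<in> H) \<and> (\<forall>x\<in>H. star G x \<in> H)"

definition partial_hom :: "('a, 'm) monoid_scheme \<Rightarrow> ('b, 'n) monoid_scheme \<Rightarrow> ('a \<Rightarrow> 'b) set" where
  "partial_hom G H = {\<pi>. \<pi> \<in> carrier G \<rightarrow> carrier H \<and>
     (\<forall>s\<in>carrier G. \<forall>t\<in>carrier G.
        \<pi> s \<otimes>\<^bsub>H\<^esub> \<pi> t \<otimes>\<^bsub>H\<^esub> \<pi> (star G t) = \<pi> (s \<otimes>\<^bsub>G\<^esub> t) \<otimes>\<^bsub>H\<^esub> \<pi> (star G t) \<and>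
        \<pi> (star G s) \<otimes>\<^bsub>H\<^esub> \<pi> s \<otimes>\<^bsub>H\<^esub> \<pi> t = \<pi> (star G s) \<otimes>\<^bsub>H\<^esub> \<pi> (s \<otimes>\<^bsub>G\<^esub> t) \<and>
        \<pi> s \<otimes>\<^bsub>H\<^esub> \<pi> (star G s) \<otimes>\<^bsub>H\<^esub> \<pi> s = \<pi> s)}"

text \<open>Quantification over all semigroups \<open>H\<close> whose elements are taken from the type \<open>'b\<close>.\<close>

definition partial_homs_are_homs :: "'b itself \<Rightarrow> ('a, 'm) monoid_scheme \<Rightarrow> bool" where
  "partial_homs_are_homs _ G \<longleftrightarrow> (\<forall>H :: 'b monoid. sgrp H \<longrightarrow> partial_hom G H \<subseteq> hom G H)"

definition nonempty_words :: "'a set \<Rightarrow> 'a list set" where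
  "nonempty_words X = lists X - {[]}"

text \<open>The congruence on the free semigroup over \<open>X\<close> generated by the pairs in \<open>R\<close>; pairs not
  consisting of nonempty words over \<open>X\<close> are disregarded.\<close>

inductive_set gen_cong :: "'a set \<Rightarrow> ('a list \<times> 'a list) set \<Rightarrow> ('a list \<times> 'a list) set"
  for X R where
  rel: "\<lbrakk>(u, v) \<in> R; u \<in> nonempty_words X; v \<in> nonempty_words X\<rbrakk> \<Longrightarrow> (u, v) \<in> gen_cong X R"
| refl: "u \<in> nonempty_words X \<Longrightarrow> (u, u) \<in> gen_cong X R"
| sym: "(u, v) \<in> gen_cong X R \<Longrightarrow> (v, u) \<in> gen_cong X R"
| trans: "\<lbrakk>(u, v) \<in> gen_cong X R; (v, w) \<in> gen_cong X R\<rbrakk> \<Longrightarrow> (u, w) \<in> gen_cong X R"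
| append: "\<lbrakk>(u, u') \<in> gen_cong X R; (v, v') \<in> gen_cong X R\<rbrakk> \<Longrightarrow> (u @ v, u' @ v') \<in> gen_cong X R"

definition presented_sgrp :: "'a set \<Rightarrow> ('a list \<times> 'a list) set \<Rightarrow> 'a list set monoid" where
  "presented_sgrp X R =
     \<lparr>carrier = nonempty_words X // gen_cong X R,
      mult = (\<lambda>A B. \<Union>u\<in>A. \<Union>v\<in>B. gen_cong X R `` {u @ v}),
      one = undefined\<rparr>"

definition Pr_relations :: "('a, 'm) monoid_scheme \<Rightarrow> ('a list \<times> 'a list) set" where
  "Pr_relations G =
     {([s, t, star G t], [s \<otimes>\<^bsub>G\<^esub> t, star G t]) | s t. s \<in> carrier G \<and> t \<in> carrier G} \<union>
     {([star G s, s, t], [star G s, s \<otimes>\<^bsub>G\<^esub> t]) | s t. s \<in> carrier G \<and> t \<in> carrier G} \<union>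
     {([s, star G s, s], [s]) | s. s \<in> carrier G}"

definition Pr :: "('a, 'm) monoid_scheme \<Rightarrow> 'a list set monoid" where
  "Pr G = presented_sgrp (carrier G) (Pr_relations G)"

definition iota :: "('a, 'm) monoid_scheme \<Rightarrow> 'a \<Rightarrow> 'a list set" where
  "iota G g = gen_cong (carrier G) (Pr_relations G) `` {[g]}"

text \<open>Extensionality (being \<open>undefined\<close> off the carrier) makes the description unique; see the
  lemma \<open>degree_map\<close> below for existence.\<close>

definition degree_map :: "('a, 'm) monoid_scheme \<Rightarrow> 'a list set \<Rightarrow> 'a" where
  "degree_map G = (THE d. d \<in> extensional (carrier (Pr G)) \<and> d \<in> hom (Pr G) G \<and>
                          (\<forall>g\<in>carrier G. d (iota G g) = g))"

text \<open>The iterates \<open>Pr G\<close>, \<open>Pr (Pr G)\<close>, \<open>\<dots>\<close> live in different types. To index them by a natural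
  number, every stage is copied into one type: an element of \<open>Pr S\<close> is encoded by a representing
  word. The lemmas \<open>iterated_Pr_0_iso\<close> and \<open>iterated_Pr_Suc_iso\<close> below show that the copies are
  faithful. (The library's \<^const>\<open>image_group\<close> transports any multiplication, not just a group's.)\<close>

datatype 'a nested = Gen 'a | Word "'a nested list"

definition encode :: "'a nested list set \<Rightarrow> 'a nested" where
  "encode C = Word (SOME w. w \<in> C)"

primrec iterated_Pr :: "('a, 'm) monoid_scheme \<Rightarrow> nat \<Rightarrow> 'a nested monoid" where
  "iterated_Pr G 0 = image_group Gen G"
| "iterated_Pr G (Suc n) = image_group encode (Pr (iterated_Pr G n))"

definition iterated_iota :: "('a, 'm) monoid_scheme \<Rightarrow> nat \<Rightarrow> 'a nested \<Rightarrow> 'a nested" where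
  "iterated_iota G n x = encode (iota (iterated_Pr G n) x)"

lemma gen_cong_words:
  assumes "(u, v) \<in> gen_cong X R"
  shows "u \<in> nonempty_words X \<and> v \<in> nonempty_words X"
  using assms by induction (auto simp: nonempty_words_def)

lemma equiv_gen_cong: "equiv (nonempty_words X) (gen_cong X R)"
proof (rule equivI)
  show "gen_cong X R \<subseteq> nonempty_words X \<times> nonempty_words X"
    using gen_cong_words by fastforce
  show "refl_on (nonempty_words X) (gen_cong X R)"
    by (auto intro!: refl_onI gen_cong.refl)
  show "Relation.sym (gen_cong X R)"
    by (auto intro: symI gen_cong.sym)
  show "Relation.trans (gen_cong X R)"
    by (auto intro: transI gen_cong.trans)
qed

lemma presented_mult_class:
  assumes u: "u \<in> nonempty_words X" and v: "v \<in> nonempty_words X"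
  shows "gen_cong X R `` {u} \<otimes>\<^bsub>presented_sgrp X R\<^esub> gen_cong X R `` {v} = gen_cong X R `` {u @ v}"
proof -
  have "gen_cong X R `` {u' @ v'} = gen_cong X R `` {u @ v}"
    if "(u, u') \<in> gen_cong X R" "(v, v') \<in> gen_cong X R" for u' v'
    using equiv_class_eq[OF equiv_gen_cong gen_cong.append[OF that]] by simp
  then have "(\<Union>u'\<in>gen_cong X R `` {u}. \<Union>v'\<in>gen_cong X R `` {v}. gen_cong X R `` {u' @ v'}) =
             gen_cong X R `` {u @ v}"
    using gen_cong.refl[OF u, of R] gen_cong.refl[OF v, of R] by blast
  then show ?thesis
    by (simp add: presented_sgrp_def)
qed

lemma presented_sgrp_is_sgrp: "sgrp (presented_sgrp X R)"
proof
  have app: "u @ v \<in> nonempty_words X" if "u \<in> nonempty_words X" "v \<in> nonempty_words X" for u v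
    using that by (auto simp: nonempty_words_def)
  have car: "\<exists>u\<in>nonempty_words X. x = gen_cong X R `` {u}"
    if "x \<in> carrier (presented_sgrp X R)" for x
    using that by (auto simp: presented_sgrp_def elim: quotientE)
  fix x y z
  assume x: "x \<in> carrier (presented_sgrp X R)" and y: "y \<in> carrier (presented_sgrp X R)"
  from x y obtain u v where u: "u \<in> nonempty_words X" "x = gen_cong X R `` {u}"
    and v: "v \<in> nonempty_words X" "y = gen_cong X R `` {v}" using car by meson
  show "x \<otimes>\<^bsub>presented_sgrp X R\<^esub> y \<in> carrier (presented_sgrp X R)"
    using u v app by (auto simp: presented_mult_class) (auto simp: presented_sgrp_def intro: quotientI)
  assume z: "z \<in> carrier (presented_sgrp X R)"
  then obtain w where w: "w \<in> nonempty_words X" "z = gen_cong X R `` {w}" using car by meson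
  show "x \<otimes>\<^bsub>presented_sgrp X R\<^esub> y \<otimes>\<^bsub>presented_sgrp X R\<^esub> z =
        x \<otimes>\<^bsub>presented_sgrp X R\<^esub> (y \<otimes>\<^bsub>presented_sgrp X R\<^esub> z)"
    using u v w app by (simp add: presented_mult_class)
qed

fun word_prod :: "('b, 'n) monoid_scheme \<Rightarrow> 'b list \<Rightarrow> 'b" where
  "word_prod H [] = undefined"
| "word_prod H [x] = x"
| "word_prod H (x # y # ys) = x \<otimes>\<^bsub>H\<^esub> word_prod H (y # ys)"

lemma (in sgrp) word_prod_closed:
  "w \<noteq> [] \<Longrightarrow> set w \<subseteq> carrier G \<Longrightarrow> word_prod G w \<in> carrier G"
  by (induction w rule: induct_list012) (auto intro: m_closed)

lemma (in sgrp) word_prod_append: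
  assumes "u \<noteq> []" "v \<noteq> []" "set u \<subseteq> carrier G" "set v \<subseteq> carrier G"
  shows "word_prod G (u @ v) = word_prod G u \<otimes> word_prod G v"
  using assms
proof (induction u rule: list_nonempty_induct)
  case (single x)
  then show ?case by (cases v) auto
next
  case (cons x xs)
  then obtain y ys where xs: "xs = y # ys" by (cases xs) auto
  with cons show ?case
    using m_assoc word_prod_closed[of xs] word_prod_closed[of v] by auto
qed

lemma presented_sgrp_universal:
  fixes H (structure)
  assumes H: "sgrp H" and f: "f \<in> X \<rightarrow> carrier H"
    and R: "\<And>u v. \<lbrakk>(u, v) \<in> R; u \<in> nonempty_words X; v \<in> nonempty_words X\<rbrakk> \<Longrightarrow>
              word_prod H (map f u) = word_prod H (map f v)"
  shows "\<exists>!d. d \<in> extensional (carrier (presented_sgrp X R)) \<and> d \<in> hom (presented_sgrp X R) H \<and>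
              (\<forall>x\<in>X. d (gen_cong X R `` {[x]}) = f x)"
proof -
  interpret sgrp H by (fact H)
  let ?P = "presented_sgrp X R" and ?c = "\<lambda>u. gen_cong X R `` {u}"
  have W: "map f u \<noteq> [] \<and> set (map f u) \<subseteq> carrier H" if "u \<in> nonempty_words X" for u
    using that f by (auto simp: nonempty_words_def)
  have car: "carrier ?P = ?c ` nonempty_words X"
    by (auto simp: presented_sgrp_def quotient_def)
  have resp: "word_prod H (map f u) = word_prod H (map f v)" if "(u, v) \<in> gen_cong X R" for u v
    using that
  proof induction
    case (append u u' v v')
    then show ?case
      using W gen_cong_words[OF append(1)] gen_cong_words[OF append(2)]
      by (simp add: word_prod_append)
  qed (use R in auto)
  define d where "d = restrict (\<lambda>C. word_prod H (map f (SOME w. w \<in> C))) (carrier ?P)"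
  have dval: "d (?c u) = word_prod H (map f u)" if u: "u \<in> nonempty_words X" for u
  proof -
    have "(SOME w. w \<in> ?c u) \<in> ?c u"
      using gen_cong.refl[OF u, of R] by (intro someI[of "\<lambda>w. w \<in> ?c u" u]) simp
    then show ?thesis using resp[of u] u by (simp add: d_def car)
  qed
  have app: "u @ v \<in> nonempty_words X" if "u \<in> nonempty_words X" "v \<in> nonempty_words X" for u v
    using that by (auto simp: nonempty_words_def)
  have sing: "[x] \<in> nonempty_words X" if "x \<in> X" for x
    using that by (auto simp: nonempty_words_def)
  show ?thesis
  proof (rule ex1I[of _ d], intro conjI ballI)
    show "d \<in> extensional (carrier ?P)" by (simp add: d_def)
    show "d \<in> hom ?P H"
    proof (rule homI)
      fix x assume "x \<in> carrier ?P"
      then show "d x \<in> carrier H" using dval W word_prod_closed by (auto simp: car)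
    next
      fix x y assume "x \<in> carrier ?P" "y \<in> carrier ?P"
      then obtain u v where u: "u \<in> nonempty_words X" "x = ?c u"
        and v: "v \<in> nonempty_words X" "y = ?c v" by (auto simp: car)
      have "word_prod H (map f u @ map f v) = word_prod H (map f u) \<otimes> word_prod H (map f v)"
        using W[OF u(1)] W[OF v(1)] by (intro word_prod_append) blast+
      then show "d (x \<otimes>\<^bsub>?P\<^esub> y) = d x \<otimes> d y"
        by (simp add: u v presented_mult_class dval app)
    qed
    show "d (?c [x]) = f x" if "x \<in> X" for x using dval sing that by simp
  next
    fix e assume e: "e \<in> extensional (carrier ?P) \<and> e \<in> hom ?P H \<and> (\<forall>x\<in>X. e (?c [x]) = f x)"
    have eval: "e (?c u) = word_prod H (map f u)" if u: "u \<in> nonempty_words X" for u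
    proof -
      have "u \<noteq> []" "set u \<subseteq> X" using u by (auto simp: nonempty_words_def)
      then show ?thesis
      proof (induction u rule: list_nonempty_induct)
        case (single x) then show ?case using e by simp
      next
        case (cons x xs)
        have xs: "xs \<in> nonempty_words X" and x: "[x] \<in> nonempty_words X"
          using cons by (auto simp: nonempty_words_def)
        have "?c (x # xs) = ?c [x] \<otimes>\<^bsub>?P\<^esub> ?c xs"
          using presented_mult_class[OF x xs, of R] by simp
        moreover have "?c [x] \<in> carrier ?P" "?c xs \<in> carrier ?P" using x xs by (auto simp: car)
        ultimately have "e (?c (x # xs)) = e (?c [x]) \<otimes> e (?c xs)"
          using e by (auto simp: hom_def)
        then show ?case using cons e by (cases xs) auto
      qed
    qed
    show "e = d"
    proof (rule extensionalityI[of e "carrier ?P" d])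
      show "e \<in> extensional (carrier ?P)" using e by simp
      show "d \<in> extensional (carrier ?P)" by (simp add: d_def)
      show "e x = d x" if "x \<in> carrier ?P" for x using that dval eval by (auto simp: car)
    qed
  qed
qed

lemma (in inverse_sgrp) star:
  assumes "s \<in> carrier G"
  shows "star G s \<in> carrier G" "s \<otimes> star G s \<otimes> s = s" "star G s \<otimes> s \<otimes> star G s = star G s"
  using theI'[OF unique_inverse[OF assms]] unfolding star_def by blast+

lemma (in inverse_sgrp) degree_map:
  "degree_map G \<in> extensional (carrier (Pr G))" "degree_map G \<in> hom (Pr G) G"
  "g \<in> carrier G \<Longrightarrow> degree_map G (iota G g) = g"
proof -
  have "\<exists>!d. d \<in> extensional (carrier (Pr G)) \<and> d \<in> hom (Pr G) G \<and>
             (\<forall>x\<in>carrier G. d (iota G x) = (\<lambda>x. x) x)"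
    unfolding Pr_def iota_def
  proof (rule presented_sgrp_universal)
    show "sgrp G" by (rule sgrp_axioms)
    show "word_prod G (map (\<lambda>x. x) u) = word_prod G (map (\<lambda>x. x) v)"
      if "(u, v) \<in> Pr_relations G" for u v
      using that unfolding Pr_relations_def
      by (elim UnE CollectE exE conjE) (use star m_assoc in simp_all)
  qed simp
  from theI'[OF this, folded degree_map_def]
  show "degree_map G \<in> extensional (carrier (Pr G))" "degree_map G \<in> hom (Pr G) G"
    "g \<in> carrier G \<Longrightarrow> degree_map G (iota G g) = g"
    by blast+
qed

lemma image_group_iso:
  assumes "sgrp S" "inj_on f (carrier S)"
  shows "f \<in> iso S (image_group f S)"
  using assms by (auto simp: iso_def hom_def image_group_def bij_betw_def)

lemma encode_inj: "inj_on encode (carrier (Pr S))"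
proof (rule inj_onI)
  let ?C = "gen_cong (carrier S) (Pr_relations S)"
  fix A B assume A: "A \<in> carrier (Pr S)" and B: "B \<in> carrier (Pr S)" and eq: "encode A = encode B"
  have "A \<in> nonempty_words (carrier S) // ?C" "B \<in> nonempty_words (carrier S) // ?C"
    using A B by (auto simp: Pr_def presented_sgrp_def)
  moreover have "(SOME w. w \<in> A) \<in> A" "(SOME w. w \<in> B) \<in> B"
    using calculation in_quotient_imp_non_empty[OF equiv_gen_cong] by (metis some_in_eq)+
  ultimately show "A = B"
    using quotient_disj[OF equiv_gen_cong, of A _ _ B] eq by (auto simp: encode_def)
qed

lemma iterated_Pr_0_iso: "sgrp G \<Longrightarrow> Gen \<in> iso G (iterated_Pr G 0)"
  by (simp add: image_group_iso inj_on_def)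

lemma iterated_Pr_Suc_iso: "encode \<in> iso (Pr (iterated_Pr G n)) (iterated_Pr G (Suc n))"
proof -
  have "sgrp (Pr (iterated_Pr G n))" unfolding Pr_def by (rule presented_sgrp_is_sgrp)
  then show ?thesis by (simp add: image_group_iso encode_inj)
qed

end

theory Submission
  imports Defs
begin

text \<open>Let \<open>s\<close> be an element of \<open>G\<close> and \<open>f = star G s \<otimes> s\<close>. Sending \<open>t\<close> to the truth value of
  \<open>f \<le> t\<close> (natural order) is a partial homomorphism into the two-element semilattice, so if the
  canonical map is a homomorphism, then \<open>f \<le> s\<close> and \<open>s = f\<close> is idempotent. Conversely, partial
  homomorphisms are multiplicative on idempotents. For the chain of inclusions one needs \<open>Pr G\<close> to be
  an inverse semigroup: the elements \<open>\<epsilon>(s) = [s][star G s]\<close> are commuting idempotents, every element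
  is a product of such elements times some \<open>[s]\<close>, which yields regularity, and the degree map shows
  that every idempotent is a product of elements \<open>\<epsilon>(s)\<close>. Being a semilattice descends along the degree
  map, so no iterate of \<open>Pr\<close> is one unless \<open>G\<close> is.\<close>

section \<open>Inverse semigroups\<close>

text \<open>Two inverses \<open>y\<close> and \<open>z\<close> of \<open>x\<close> both equal
  \<open>y \<otimes> x \<otimes> z\<close>: one computation swaps \<open>x \<otimes> z\<close> with
  \<open>x \<otimes> y\<close>, the other \<open>y \<otimes> x\<close> with
  \<open>z \<otimes> x\<close>. This is the criterion applied to \<open>Pr G\<close> and to
  injective copies.\<close>

lemma (in sgrp) inverse_sgrpI:
  assumes regular: "\<And>x. x \<in> carrier G \<Longrightarrow> \<exists>y\<in>carrier G. x \<otimes> y \<otimes> x = x \<and> y \<otimes> x \<otimes> y = y"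
    and comm: "\<And>e f. \<lbrakk>e \<in> idempotents G; f \<in> idempotents G\<rbrakk> \<Longrightarrow> e \<otimes> f = f \<otimes> e"
  shows "inverse_sgrp G"
proof
  note [simp] = m_closed m_assoc
  fix x assume x: "x \<in> carrier G"
  have "y = z" if y: "y \<in> carrier G" "x \<otimes> y \<otimes> x = x" "y \<otimes> x \<otimes> y = y"
    and z: "z \<in> carrier G" "x \<otimes> z \<otimes> x = x" "z \<otimes> x \<otimes> z = z" for y z
  proof -
    have idem: "x \<otimes> y \<in> idempotents G" "y \<otimes> x \<in> idempotents G"
      "x \<otimes> z \<in> idempotents G" "z \<otimes> x \<in> idempotents G"
      using x y z unfolding idempotents_def by (auto simp flip: m_assoc)
    have "y = y \<otimes> (x \<otimes> z \<otimes> x) \<otimes> y" by (simp only: y(3) z(2))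
    also have "\<dots> = y \<otimes> ((x \<otimes> z) \<otimes> (x \<otimes> y))" using x y(1) z(1) by simp
    also have "\<dots> = y \<otimes> ((x \<otimes> y) \<otimes> (x \<otimes> z))" using comm[OF idem(3,1)] by simp
    also have "\<dots> = (y \<otimes> x \<otimes> y) \<otimes> x \<otimes> z" using x y(1) z(1) by simp
    also have "\<dots> = y \<otimes> x \<otimes> z" by (simp only: y(3))
    also have "\<dots> = (y \<otimes> x) \<otimes> (z \<otimes> x) \<otimes> z" using x y(1) z by simp
    also have "\<dots> = (z \<otimes> x) \<otimes> (y \<otimes> x) \<otimes> z" using comm[OF idem(2,4)] by simp
    also have "\<dots> = z \<otimes> (x \<otimes> y \<otimes> x) \<otimes> z" using x y(1) z(1) by simp
    also have "\<dots> = z" by (simp only: y(2) z(3))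
    finally show ?thesis .
  qed
  then show "\<exists>!t. t \<in> carrier G \<and> x \<otimes> t \<otimes> x = x \<and> t \<otimes> x \<otimes> t = t"
    using regular[OF x] by blast
qed

lemma idempotents_closed: "e \<in> idempotents G \<Longrightarrow> e \<in> carrier G"
  by (simp add: idempotents_def)

lemma idempotents_idem: "e \<in> idempotents G \<Longrightarrow> e \<otimes>\<^bsub>G\<^esub> e = e"
  by (simp add: idempotents_def)

context inverse_sgrp
begin

lemma star_unique:
  assumes "s \<in> carrier G" "t \<in> carrier G" "s \<otimes> t \<otimes> s = s" "t \<otimes> s \<otimes> t = t"
  shows "star G s = t"
  using unique_inverse[OF assms(1)] star[OF assms(1)] assms by blast

lemma star_star: "s \<in> carrier G \<Longrightarrow> star G (star G s) = s"
  using star by (intro star_unique)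

lemma star_idempotent: "e \<in> idempotents G \<Longrightarrow> star G e = e"
  by (intro star_unique) (auto simp: idempotents_def)

lemma range_idempotent: "s \<in> carrier G \<Longrightarrow> s \<otimes> star G s \<in> idempotents G"
  using star[of s] by (simp add: idempotents_def m_closed flip: m_assoc)

lemma source_idempotent: "s \<in> carrier G \<Longrightarrow> star G s \<otimes> s \<in> idempotents G"
  using range_idempotent[of "star G s"] by (simp add: star star_star)

text \<open>If \<open>z\<close> is the inverse of \<open>e \<otimes> f\<close>, then
  \<open>f \<otimes> z \<otimes> e\<close> is an inverse of it as well, so it equals
  \<open>z\<close> by uniqueness. This form shows that \<open>z\<close> is idempotent, hence its own
  inverse, that is, \<open>z = e \<otimes> f\<close>.\<close>

lemma idempotents_m_closed:
  assumes e: "e \<in> idempotents G" and f: "f \<in> idempotents G"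
  shows "e \<otimes> f \<in> idempotents G"
proof -
  note [simp] = m_closed m_assoc
  have c: "e \<in> carrier G" "f \<in> carrier G" and i: "e \<otimes> e = e" "f \<otimes> f = f"
    using e f by (auto simp: idempotents_def)
  have i': "e \<otimes> (e \<otimes> x) = e \<otimes> x" "f \<otimes> (f \<otimes> x) = f \<otimes> x" if "x \<in> carrier G" for x
    using c i that by (simp_all flip: m_assoc)
  define z where "z = star G (e \<otimes> f)"
  have z: "z \<in> carrier G" "e \<otimes> f \<otimes> z \<otimes> (e \<otimes> f) = e \<otimes> f" "z \<otimes> (e \<otimes> f) \<otimes> z = z"
    unfolding z_def using star[of "e \<otimes> f"] c by (simp_all only: m_closed)
  have z': "e \<otimes> (f \<otimes> (z \<otimes> (e \<otimes> f))) = e \<otimes> f" "z \<otimes> (e \<otimes> (f \<otimes> z)) = z"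
    using z c by simp_all
  have z'': "z \<otimes> (e \<otimes> (f \<otimes> (z \<otimes> x))) = z \<otimes> x" if "x \<in> carrier G" for x
    using arg_cong[OF z'(2), of "\<lambda>y. y \<otimes> x"] z(1) c that by simp
  have "f \<otimes> z \<otimes> e = z"
    using star_unique[of "e \<otimes> f" "f \<otimes> z \<otimes> e"] c z(1) z' z'' i i' unfolding z_def[symmetric] by simp
  moreover have "f \<otimes> z \<otimes> e \<otimes> (f \<otimes> z \<otimes> e) = f \<otimes> z \<otimes> e"
    using c z(1) z'' by simp
  ultimately have "z \<in> idempotents G" using z(1) by (simp add: idempotents_def)
  moreover have "star G z = e \<otimes> f" using c star_star by (simp add: z_def)
  ultimately show ?thesis using star_idempotent by simp
qed

text \<open>Since \<open>e \<otimes> f\<close> and \<open>f \<otimes> e\<close> are idempotent, they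
  are inverse to each other; but an idempotent is its own inverse.\<close>

lemma idempotents_comm:
  assumes e: "e \<in> idempotents G" and f: "f \<in> idempotents G"
  shows "e \<otimes> f = f \<otimes> e"
proof -
  note [simp] = m_closed m_assoc
  have c: "e \<in> carrier G" "f \<in> carrier G" and i: "e \<otimes> e = e" "f \<otimes> f = f"
    using e f by (auto simp: idempotents_def)
  have i': "e \<otimes> (e \<otimes> x) = e \<otimes> x" "f \<otimes> (f \<otimes> x) = f \<otimes> x" if "x \<in> carrier G" for x
    using c i that by (simp_all flip: m_assoc)
  have "e \<otimes> (f \<otimes> (e \<otimes> f)) = e \<otimes> f" "f \<otimes> (e \<otimes> (f \<otimes> e)) = f \<otimes> e"
    using idempotents_m_closed[OF e f] idempotents_m_closed[OF f e] c by (auto simp: idempotents_def)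
  then have "star G (e \<otimes> f) = f \<otimes> e" using c i' by (intro star_unique) auto
  then show ?thesis using star_idempotent[OF idempotents_m_closed[OF e f]] by simp
qed

text \<open>In both equations the inner idempotents \<open>star G s \<otimes> s\<close> and
  \<open>t \<otimes> star G t\<close> meet; swapping them brings each next to the factor that
  absorbs it.\<close>

lemma star_mult:
  assumes s: "s \<in> carrier G" and t: "t \<in> carrier G"
  shows "star G (s \<otimes> t) = star G t \<otimes> star G s"
proof (rule star_unique)
  note [simp] = m_closed m_assoc
  let ?s = "star G s" and ?t = "star G t"
  note c = s t star(1)[OF s] star(1)[OF t]
  have comm: "(?s \<otimes> s) \<otimes> (t \<otimes> ?t) = (t \<otimes> ?t) \<otimes> (?s \<otimes> s)"
    by (rule idempotents_comm[OF source_idempotent[OF s] range_idempotent[OF t]])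
  have "s \<otimes> t \<otimes> (?t \<otimes> ?s) \<otimes> (s \<otimes> t) = s \<otimes> ((t \<otimes> ?t) \<otimes> (?s \<otimes> s)) \<otimes> t" using c by simp
  also have "\<dots> = s \<otimes> ((?s \<otimes> s) \<otimes> (t \<otimes> ?t)) \<otimes> t" by (simp only: comm)
  also have "\<dots> = (s \<otimes> ?s \<otimes> s) \<otimes> (t \<otimes> ?t \<otimes> t)" using c by simp
  finally show "s \<otimes> t \<otimes> (?t \<otimes> ?s) \<otimes> (s \<otimes> t) = s \<otimes> t" using star[OF s] star[OF t] by simp
  have "?t \<otimes> ?s \<otimes> (s \<otimes> t) \<otimes> (?t \<otimes> ?s) = ?t \<otimes> ((?s \<otimes> s) \<otimes> (t \<otimes> ?t)) \<otimes> ?s" using c by simp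
  also have "\<dots> = ?t \<otimes> ((t \<otimes> ?t) \<otimes> (?s \<otimes> s)) \<otimes> ?s" by (simp only: comm)
  also have "\<dots> = (?t \<otimes> t \<otimes> ?t) \<otimes> (?s \<otimes> s \<otimes> ?s)" using c by simp
  finally show "?t \<otimes> ?s \<otimes> (s \<otimes> t) \<otimes> (?t \<otimes> ?s) = ?t \<otimes> ?s" using star[OF s] star[OF t] by simp
qed (use s t star m_closed in auto)

lemma semilattice_iff_idempotents: "semilattice_sgrp G \<longleftrightarrow> carrier G = idempotents G"
proof
  assume "semilattice_sgrp G"
  then interpret semilattice_sgrp G .
  show "carrier G = idempotents G" using m_idem by (auto simp: idempotents_def)
next
  assume eq: "carrier G = idempotents G"
  show "semilattice_sgrp G"
  proof
    show "x \<otimes> y = y \<otimes> x" if "x \<in> carrier G" "y \<in> carrier G" for x y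
      using idempotents_comm that eq by blast
    show "x \<otimes> x = x" if "x \<in> carrier G" for x
      using that unfolding eq by (rule idempotents_idem)
  qed
qed

end

section \<open>Homomorphic images and injective copies\<close>

lemma hom_idempotents: "\<lbrakk>h \<in> hom G H; e \<in> idempotents G\<rbrakk> \<Longrightarrow> h e \<in> idempotents H"
  by (auto simp: idempotents_def hom_def) metis

text \<open>Only idempotency is carried over by \<open>h\<close>; commutativity then comes from the
  commuting idempotents of \<open>H\<close>.\<close>

lemma semilattice_sgrp_epi:
  assumes G: "semilattice_sgrp G" and H: "inverse_sgrp H"
    and h: "h \<in> hom G H" "h ` carrier G = carrier H"
  shows "semilattice_sgrp H"
proof -
  interpret G: semilattice_sgrp G by (fact G)
  interpret H: inverse_sgrp H by (fact H)
  have "carrier G = idempotents G" using G.m_idem by (auto simp: idempotents_def)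
  then have "carrier H \<subseteq> idempotents H" using hom_idempotents[OF h(1)] by (auto simp flip: h(2))
  then have "carrier H = idempotents H" by (rule equalityI) (auto simp: idempotents_def)
  then show ?thesis by (simp add: H.semilattice_iff_idempotents)
qed

lemma image_group_inverse_sgrp:
  assumes S: "inverse_sgrp S" and inj: "inj_on f (carrier S)"
  shows "inverse_sgrp (image_group f S)"
proof -
  interpret inverse_sgrp S by (fact S)
  let ?T = "image_group f S"
  have car: "carrier ?T = f ` carrier S" by (simp add: image_group_def)
  have mult: "f x \<otimes>\<^bsub>?T\<^esub> f y = f (x \<otimes>\<^bsub>S\<^esub> y)" if "x \<in> carrier S" "y \<in> carrier S" for x y
    using that inj by (simp add: image_group_def)
  interpret T: sgrp ?T
    by standard (auto simp: car mult m_closed m_assoc)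
  show ?thesis
  proof (rule T.inverse_sgrpI)
    fix x assume "x \<in> carrier ?T"
    then obtain s where s: "s \<in> carrier S" "x = f s" by (auto simp: car)
    then show "\<exists>y\<in>carrier ?T. x \<otimes>\<^bsub>?T\<^esub> y \<otimes>\<^bsub>?T\<^esub> x = x \<and> y \<otimes>\<^bsub>?T\<^esub> x \<otimes>\<^bsub>?T\<^esub> y = y"
      using star[OF s(1)] by (intro bexI[of _ "f (star S s)"]) (auto simp: car mult m_closed)
  next
    have idem: "\<exists>a\<in>idempotents S. e = f a" if "e \<in> idempotents ?T" for e
    proof -
      obtain a where a: "a \<in> carrier S" "e = f a" "f (a \<otimes>\<^bsub>S\<^esub> a) = f a"
        using \<open>e \<in> idempotents ?T\<close> by (auto simp: idempotents_def car mult)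
      then have "a \<otimes>\<^bsub>S\<^esub> a = a" using inj by (simp add: inj_on_eq_iff m_closed)
      then show ?thesis using a by (auto simp: idempotents_def)
    qed
    fix e e' assume "e \<in> idempotents ?T" "e' \<in> idempotents ?T"
    then obtain a b where "a \<in> idempotents S" "e = f a" "b \<in> idempotents S" "e' = f b"
      using idem by meson
    then show "e \<otimes>\<^bsub>?T\<^esub> e' = e' \<otimes>\<^bsub>?T\<^esub> e"
      using idempotents_comm[of a b] by (simp add: mult idempotents_closed)
  qed
qed

section \<open>Partial homomorphisms\<close>

text \<open>The target is any semigroup, so that the same calculations serve two purposes: with
  \<open>\<pi> = iota G\<close> they describe \<open>Pr G\<close>, and for general
  \<open>\<pi>\<close> they show that partial homomorphisms of semilattices are
  homomorphisms.\<close>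

locale partial_homomorphism = G: inverse_sgrp G + H: sgrp H
  for G (structure) and H (structure) +
  fixes \<pi>
  assumes partial_hom: "\<pi> \<in> partial_hom G H"
begin

lemma closed [simp]: "s \<in> carrier G \<Longrightarrow> \<pi> s \<in> carrier H"
  using partial_hom by (auto simp: partial_hom_def)

text \<open>The second law of a partial homomorphism taken at \<open>star G s\<close>. This rule and
  the next two are bracketed to the right, to match the simplifier's normal form under
  associativity.\<close>

lemma left_rule:
  "\<lbrakk>s \<in> carrier G; t \<in> carrier G\<rbrakk> \<Longrightarrow> \<pi> s \<otimes>\<^bsub>H\<^esub> (\<pi> (star G s) \<otimes>\<^bsub>H\<^esub> \<pi> t) = \<pi> s \<otimes>\<^bsub>H\<^esub> \<pi> (star G s \<otimes> t)"
  using partial_hom G.star(1)[of s] unfolding partial_hom_def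
  by (simp add: G.star_star Pi_iff flip: H.m_assoc) (metis G.star_star)

lemma right_rule:
  "\<lbrakk>s \<in> carrier G; t \<in> carrier G\<rbrakk> \<Longrightarrow> \<pi> s \<otimes>\<^bsub>H\<^esub> (\<pi> t \<otimes>\<^bsub>H\<^esub> \<pi> (star G t)) = \<pi> (s \<otimes> t) \<otimes>\<^bsub>H\<^esub> \<pi> (star G t)"
  using partial_hom G.star(1)[of t] unfolding partial_hom_def
  by (auto simp flip: H.m_assoc)

lemma regular_rule:
  "s \<in> carrier G \<Longrightarrow> \<pi> s \<otimes>\<^bsub>H\<^esub> (\<pi> (star G s) \<otimes>\<^bsub>H\<^esub> \<pi> s) = \<pi> s"
  using partial_hom G.star(1)[of s] unfolding partial_hom_def
  by (auto simp flip: H.m_assoc)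

lemma idem:
  assumes e: "e \<in> idempotents G"
  shows "\<pi> e \<otimes>\<^bsub>H\<^esub> \<pi> e = \<pi> e"
  using left_rule[of e e] regular_rule[of e] e
  by (simp add: G.star_idempotent idempotents_closed idempotents_idem)

text \<open>Idempotents are self-inverse, so the right rule at \<open>f\<close> gives
  \<open>\<pi> (e \<otimes> f) \<otimes> \<pi> f\<close>, and the left rule at
  \<open>e \<otimes> f\<close> turns this into the square of
  \<open>\<pi> (e \<otimes> f)\<close>.\<close>

lemma mult_idempotents:
  assumes e: "e \<in> idempotents G" and f: "f \<in> idempotents G"
  shows "\<pi> e \<otimes>\<^bsub>H\<^esub> \<pi> f = \<pi> (e \<otimes> f)"
proof -
  have c: "e \<in> carrier G" "f \<in> carrier G" and i: "e \<otimes> e = e" "f \<otimes> f = f"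
    using e f by (auto simp: idempotents_def)
  have ef: "e \<otimes> f \<in> idempotents G" by (rule G.idempotents_m_closed[OF e f])
  have "\<pi> e \<otimes>\<^bsub>H\<^esub> \<pi> f = \<pi> (e \<otimes> f) \<otimes>\<^bsub>H\<^esub> \<pi> f"
    using right_rule[of e f] c by (simp add: G.star_idempotent f idem)
  also have "\<dots> = \<pi> (e \<otimes> f) \<otimes>\<^bsub>H\<^esub> \<pi> (e \<otimes> f \<otimes> f)"
    using left_rule[of "e \<otimes> f" f] c ef
    by (simp add: G.star_idempotent idem G.m_closed flip: H.m_assoc)
  also have "\<dots> = \<pi> (e \<otimes> f)"
    using c i idem[OF ef] by (simp add: G.m_assoc)
  finally show ?thesis .
qed

lemma range_mult: "s \<in> carrier G \<Longrightarrow> \<pi> (s \<otimes> star G s) \<otimes>\<^bsub>H\<^esub> \<pi> s = \<pi> s"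
  using right_rule[of "s \<otimes> star G s" s] regular_rule[of s] G.star[of s]
    H.m_assoc[of "\<pi> (s \<otimes> star G s)" "\<pi> s \<otimes>\<^bsub>H\<^esub> \<pi> (star G s)" "\<pi> s"]
  by (simp add: G.m_closed H.m_closed H.m_assoc)

lemma mult_source: "s \<in> carrier G \<Longrightarrow> \<pi> s \<otimes>\<^bsub>H\<^esub> \<pi> (star G s \<otimes> s) = \<pi> s"
  using left_rule[of s s] regular_rule[of s] by simp

text \<open>The left rule replaces \<open>s\<close> by \<open>x = e \<otimes> s\<close>. Splitting
  off the range idempotent of \<open>x\<close> on the left then lets it absorb
  \<open>\<pi> e\<close>, because \<open>e \<otimes> x = x\<close>. The next lemma is the mirror
  image.\<close>

lemma idempotent_mult:
  assumes e: "e \<in> idempotents G" and s: "s \<in> carrier G"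
  shows "\<pi> e \<otimes>\<^bsub>H\<^esub> \<pi> s = \<pi> (e \<otimes> s)"
proof -
  have c: "e \<in> carrier G" using e by (rule idempotents_closed)
  define x where "x = e \<otimes> s"
  have x: "x \<in> carrier G" by (simp add: x_def c s G.m_closed)
  have ex: "e \<otimes> x = x" using e s c by (simp add: x_def idempotents_idem flip: G.m_assoc)
  have "\<pi> e \<otimes>\<^bsub>H\<^esub> \<pi> s = \<pi> e \<otimes>\<^bsub>H\<^esub> \<pi> x"
    using left_rule[of e s] c s by (simp add: G.star_idempotent e idem x_def flip: H.m_assoc)
  also have "\<dots> = \<pi> e \<otimes>\<^bsub>H\<^esub> \<pi> (x \<otimes> star G x) \<otimes>\<^bsub>H\<^esub> \<pi> x"
    using c x G.star[OF x] by (simp add: H.m_assoc G.m_closed range_mult)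
  also have "\<dots> = \<pi> (x \<otimes> star G x) \<otimes>\<^bsub>H\<^esub> \<pi> x"
    using mult_idempotents[OF e G.range_idempotent[OF x]] c x G.star[OF x]
    by (simp add: ex flip: G.m_assoc)
  finally show ?thesis using x by (simp add: range_mult x_def)
qed

lemma mult_idempotent:
  assumes e: "e \<in> idempotents G" and s: "s \<in> carrier G"
  shows "\<pi> s \<otimes>\<^bsub>H\<^esub> \<pi> e = \<pi> (s \<otimes> e)"
proof -
  have c: "e \<in> carrier G" using e by (rule idempotents_closed)
  define x where "x = s \<otimes> e"
  have x: "x \<in> carrier G" by (simp add: x_def c s G.m_closed)
  have xe: "x \<otimes> e = x" using e s c by (simp add: x_def idempotents_idem G.m_assoc)
  have "\<pi> s \<otimes>\<^bsub>H\<^esub> \<pi> e = \<pi> x \<otimes>\<^bsub>H\<^esub> \<pi> e"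
    using right_rule[of s e] c s by (simp add: G.star_idempotent e idem x_def)
  also have "\<dots> = \<pi> x \<otimes>\<^bsub>H\<^esub> (\<pi> (star G x \<otimes> x) \<otimes>\<^bsub>H\<^esub> \<pi> e)"
    using c x G.star[OF x] by (simp add: G.m_closed mult_source flip: H.m_assoc)
  also have "\<dots> = \<pi> x \<otimes>\<^bsub>H\<^esub> \<pi> (star G x \<otimes> x)"
    using mult_idempotents[OF G.source_idempotent[OF x] e] c x G.star[OF x]
    by (simp add: xe G.m_assoc)
  finally show ?thesis using x by (simp add: mult_source x_def)
qed

section \<open>Range idempotents of the elements \<open>\<pi> s\<close>\<close>

definition eps where "eps s = \<pi> s \<otimes>\<^bsub>H\<^esub> \<pi> (star G s)"

lemma eps_closed [simp]: "s \<in> carrier G \<Longrightarrow> eps s \<in> carrier H"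
  by (simp add: eps_def H.m_closed G.star)

lemma eps_mult: "s \<in> carrier G \<Longrightarrow> eps s \<otimes>\<^bsub>H\<^esub> \<pi> s = \<pi> s"
  by (simp add: eps_def H.m_assoc G.star regular_rule)

lemma eps_idem: "s \<in> carrier G \<Longrightarrow> eps s \<otimes>\<^bsub>H\<^esub> eps s = eps s"
  using H.m_assoc[of "eps s" "\<pi> s" "\<pi> (star G s)"] eps_mult[of s] by (metis G.star(1) closed eps_closed eps_def)

lemma eps_idempotent: "e \<in> idempotents G \<Longrightarrow> eps e = \<pi> e"
  by (simp add: eps_def G.star_idempotent idem)

text \<open>This measures how far \<open>\<pi>\<close> is from being multiplicative: the defect is
  an idempotent on the left. Insert \<open>\<pi> (star G s) \<otimes> \<pi> s\<close> after
  \<open>\<pi> s\<close> and apply the second law.\<close>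

lemma mult_eq_eps:
  assumes s: "s \<in> carrier G" and t: "t \<in> carrier G"
  shows "\<pi> s \<otimes>\<^bsub>H\<^esub> \<pi> t = eps s \<otimes>\<^bsub>H\<^esub> \<pi> (s \<otimes> t)"
proof -
  have "\<pi> s \<otimes>\<^bsub>H\<^esub> \<pi> t = \<pi> s \<otimes>\<^bsub>H\<^esub> (\<pi> (star G s) \<otimes>\<^bsub>H\<^esub> (\<pi> s \<otimes>\<^bsub>H\<^esub> \<pi> t))"
    using regular_rule[OF s] s t G.star[OF s] by (simp add: H.m_closed flip: H.m_assoc)
  also have "\<pi> (star G s) \<otimes>\<^bsub>H\<^esub> (\<pi> s \<otimes>\<^bsub>H\<^esub> \<pi> t) = \<pi> (star G s) \<otimes>\<^bsub>H\<^esub> \<pi> (s \<otimes> t)"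
    using left_rule[of "star G s" t] s t by (simp add: G.star G.star_star)
  finally show ?thesis using s t by (simp add: eps_def H.m_assoc G.m_closed G.star)
qed

text \<open>Moving \<open>e\<close> to the right through \<open>t\<close> conjugates it to the
  idempotent \<open>star G t \<otimes> e \<otimes> t\<close>; moving that through
  \<open>star G t\<close> conjugates back and leaves \<open>e\<close>.\<close>

lemma idempotent_mult_eps:
  assumes e: "e \<in> idempotents G" and t: "t \<in> carrier G"
  shows "\<pi> e \<otimes>\<^bsub>H\<^esub> eps t = eps t \<otimes>\<^bsub>H\<^esub> \<pi> e"
proof -
  note [simp] = G.m_closed H.m_closed G.m_assoc
  let ?t = "star G t"
  have c: "e \<in> carrier G" "?t \<in> carrier G" using e t by (simp_all add: idempotents_closed G.star)
  have comm: "e \<otimes> (t \<otimes> ?t) = (t \<otimes> ?t) \<otimes> e"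
    by (rule G.idempotents_comm[OF e G.range_idempotent[OF t]])
  have et: "e \<otimes> t = t \<otimes> (?t \<otimes> (e \<otimes> t))"
    using arg_cong[OF comm, of "\<lambda>y. y \<otimes> t"] c t G.star(2)[OF t] by simp
  have f: "?t \<otimes> (e \<otimes> t) \<in> idempotents G"
    using c t e arg_cong[OF et, of "\<lambda>y. ?t \<otimes> (e \<otimes> y)"]
    by (auto simp: idempotents_def simp flip: et) (metis G.m_assoc G.m_closed)
  have te: "?t \<otimes> (e \<otimes> (t \<otimes> ?t)) = ?t \<otimes> e"
    using c t G.star(3)[OF t] unfolding comm by (simp flip: G.m_assoc)
  have "\<pi> e \<otimes>\<^bsub>H\<^esub> eps t = \<pi> (e \<otimes> t) \<otimes>\<^bsub>H\<^esub> \<pi> ?t"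
    using e t c by (simp add: eps_def idempotent_mult flip: H.m_assoc)
  also have "\<pi> (e \<otimes> t) = \<pi> t \<otimes>\<^bsub>H\<^esub> \<pi> (?t \<otimes> (e \<otimes> t))"
    using mult_idempotent[OF f t] et by simp
  also have "\<dots> \<otimes>\<^bsub>H\<^esub> \<pi> ?t = \<pi> t \<otimes>\<^bsub>H\<^esub> \<pi> (?t \<otimes> e)"
    using idempotent_mult[OF f c(2)] c t te by (simp add: H.m_assoc)
  also have "\<dots> = eps t \<otimes>\<^bsub>H\<^esub> \<pi> e"
    using mult_idempotent[OF e c(2)] c t by (simp add: H.m_assoc eps_def)
  finally show ?thesis .
qed

lemma eps_idempotent_mult:
  assumes e: "e \<in> idempotents G" and t: "t \<in> carrier G"
  shows "eps (e \<otimes> t) = eps t \<otimes>\<^bsub>H\<^esub> \<pi> e"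
proof -
  note [simp] = H.m_closed H.m_assoc
  have c: "e \<in> carrier G" "star G t \<in> carrier G" using e t by (simp_all add: idempotents_closed G.star)
  have "eps (e \<otimes> t) = (\<pi> e \<otimes>\<^bsub>H\<^esub> \<pi> t) \<otimes>\<^bsub>H\<^esub> (\<pi> (star G t) \<otimes>\<^bsub>H\<^esub> \<pi> e)"
    using e t c by (simp only: eps_def G.star_mult G.star_idempotent idempotent_mult mult_idempotent)
  also have "\<dots> = (\<pi> e \<otimes>\<^bsub>H\<^esub> eps t) \<otimes>\<^bsub>H\<^esub> \<pi> e" using c t by (simp add: eps_def)
  also have "\<dots> = eps t \<otimes>\<^bsub>H\<^esub> \<pi> e"
    using c t by (simp add: idempotent_mult_eps[OF e t] idem[OF e])
  finally show ?thesis .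
qed

text \<open>The right rule and \<open>mult_eq_eps\<close> give the claim with
  \<open>t \<otimes> s \<otimes> star G s\<close> in place of \<open>t\<close>. After
  \<open>eps (t \<otimes> s)\<close>, by the left rule, only the product with
  \<open>star G (t \<otimes> s)\<close> counts, and there the two elements agree.\<close>

lemma mult_eps:
  assumes s: "s \<in> carrier G" and t: "t \<in> carrier G"
  shows "\<pi> t \<otimes>\<^bsub>H\<^esub> eps s = eps (t \<otimes> s) \<otimes>\<^bsub>H\<^esub> \<pi> t"
proof -
  let ?s = "star G s" and ?t = "star G t"
  have c: "?s \<in> carrier G" "?t \<in> carrier G" "t \<otimes> s \<in> carrier G"
    using s t by (simp_all add: G.star G.m_closed)
  have "?s \<otimes> ((?t \<otimes> t) \<otimes> (s \<otimes> ?s)) = ?s \<otimes> ((s \<otimes> ?s) \<otimes> (?t \<otimes> t))"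
    using G.idempotents_comm[OF G.source_idempotent[OF t] G.range_idempotent[OF s]] by simp
  also have "\<dots> = ?s \<otimes> ?t \<otimes> t" using s t c G.star(3)[OF s] by (simp add: G.m_closed flip: G.m_assoc)
  finally have eq: "?s \<otimes> ?t \<otimes> (t \<otimes> s \<otimes> ?s) = ?s \<otimes> ?t \<otimes> t"
    using s t c by (simp add: G.m_assoc G.m_closed)
  have "\<pi> t \<otimes>\<^bsub>H\<^esub> eps s = \<pi> (t \<otimes> s) \<otimes>\<^bsub>H\<^esub> \<pi> ?s"
    using s t by (simp add: eps_def right_rule)
  also have "\<dots> = eps (t \<otimes> s) \<otimes>\<^bsub>H\<^esub> \<pi> (t \<otimes> s \<otimes> ?s)"
    using c by (simp add: mult_eq_eps)
  also have "\<dots> = \<pi> (t \<otimes> s) \<otimes>\<^bsub>H\<^esub> \<pi> (?s \<otimes> ?t \<otimes> (t \<otimes> s \<otimes> ?s))"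
    using s t c left_rule[of "t \<otimes> s" "t \<otimes> s \<otimes> ?s"]
    by (simp add: eps_def H.m_assoc G.m_closed G.star_mult)
  also have "\<dots> = eps (t \<otimes> s) \<otimes>\<^bsub>H\<^esub> \<pi> t"
    using s t c left_rule[of "t \<otimes> s" t]
    by (simp add: eq eps_def H.m_assoc G.m_closed G.star_mult)
  finally show ?thesis .
qed

text \<open>Moving \<open>eps t\<close> leftwards across \<open>\<pi> (star G s)\<close> and then
  across \<open>\<pi> s\<close> turns it into \<open>eps (s \<otimes> star G s \<otimes> t)\<close>.
  The extra range idempotent of \<open>s\<close> splits off and is absorbed by
  \<open>\<pi> s\<close>.\<close>

lemma eps_comm:
  assumes s: "s \<in> carrier G" and t: "t \<in> carrier G"
  shows "eps s \<otimes>\<^bsub>H\<^esub> eps t = eps t \<otimes>\<^bsub>H\<^esub> eps s"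
proof -
  note [simp] = G.m_closed H.m_closed
  let ?s = "star G s"
  have c: "?s \<in> carrier G" using s by (simp add: G.star)
  have "eps s \<otimes>\<^bsub>H\<^esub> eps t = \<pi> s \<otimes>\<^bsub>H\<^esub> (\<pi> ?s \<otimes>\<^bsub>H\<^esub> eps t)"
    using s t c by (simp add: eps_def[of s] H.m_assoc)
  also have "\<dots> = (\<pi> s \<otimes>\<^bsub>H\<^esub> eps (?s \<otimes> t)) \<otimes>\<^bsub>H\<^esub> \<pi> ?s"
    using s t c by (simp add: mult_eps[of t ?s] H.m_assoc)
  also have "\<dots> = eps (s \<otimes> (?s \<otimes> t)) \<otimes>\<^bsub>H\<^esub> \<pi> s \<otimes>\<^bsub>H\<^esub> \<pi> ?s"
    using s t c by (simp only: mult_eps G.m_closed)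
  also have "\<dots> = eps (s \<otimes> ?s \<otimes> t) \<otimes>\<^bsub>H\<^esub> eps s"
    using s t c by (simp add: H.m_assoc G.m_assoc eps_def[of s])
  also have "\<dots> = eps t \<otimes>\<^bsub>H\<^esub> (\<pi> (s \<otimes> ?s) \<otimes>\<^bsub>H\<^esub> \<pi> s \<otimes>\<^bsub>H\<^esub> \<pi> ?s)"
    using s t c by (simp add: eps_idempotent_mult[OF G.range_idempotent] H.m_assoc eps_def[of s])
  also have "\<dots> = eps t \<otimes>\<^bsub>H\<^esub> eps s" using s by (simp add: range_mult eps_def)
  finally show ?thesis .
qed

text \<open>The subsemigroup of \<open>H\<close> generated by the range idempotents. For
  \<open>\<pi> = iota G\<close> it turns out to contain all idempotents of
  \<open>Pr G\<close>.\<close>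

inductive_set eps_products where
  eps: "s \<in> carrier G \<Longrightarrow> eps s \<in> eps_products"
| mult: "\<lbrakk>x \<in> eps_products; y \<in> eps_products\<rbrakk> \<Longrightarrow> x \<otimes>\<^bsub>H\<^esub> y \<in> eps_products"

lemma eps_products_closed: "x \<in> eps_products \<Longrightarrow> x \<in> carrier H"
  by (induction rule: eps_products.induct) (auto intro: H.m_closed)

lemma eps_products_comm_eps:
  "\<lbrakk>x \<in> eps_products; t \<in> carrier G\<rbrakk> \<Longrightarrow> x \<otimes>\<^bsub>H\<^esub> eps t = eps t \<otimes>\<^bsub>H\<^esub> x"
proof (induction rule: eps_products.induct)
  case (eps s) then show ?case by (simp add: eps_comm)
next
  case (mult x y)
  then show ?case by (metis H.m_assoc eps_closed eps_products_closed)
qed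

lemma eps_products_comm:
  "\<lbrakk>x \<in> eps_products; y \<in> eps_products\<rbrakk> \<Longrightarrow> x \<otimes>\<^bsub>H\<^esub> y = y \<otimes>\<^bsub>H\<^esub> x"
proof (induction rule: eps_products.induct)
  case (eps s) then show ?case by (simp add: eps_products_comm_eps)
next
  case (mult x z)
  then show ?case by (metis H.m_assoc eps_products_closed)
qed

lemma eps_products_idem: "x \<in> eps_products \<Longrightarrow> x \<otimes>\<^bsub>H\<^esub> x = x"
proof (induction rule: eps_products.induct)
  case (eps s) then show ?case by (simp add: eps_idem)
next
  case (mult x y)
  then show ?case by (metis H.m_assoc H.m_closed eps_products_closed eps_products_comm)
qed

text \<open>The inverse reverses the factors, with \<open>E\<close> its own inverse. Both equations
  reduce to commuting \<open>E\<close> with \<open>eps s\<close>, after which \<open>eps s\<close>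
  is absorbed by \<open>\<pi> s\<close> or by \<open>\<pi> (star G s)\<close>. This provides the
  regularity of \<open>Pr G\<close>.\<close>

lemma normal_form_inverse:
  assumes E: "E \<in> eps_products" and s: "s \<in> carrier G"
  defines "x \<equiv> E \<otimes>\<^bsub>H\<^esub> \<pi> s" and "y \<equiv> \<pi> (star G s) \<otimes>\<^bsub>H\<^esub> E"
  shows "x \<otimes>\<^bsub>H\<^esub> y \<otimes>\<^bsub>H\<^esub> x = x" "y \<otimes>\<^bsub>H\<^esub> x \<otimes>\<^bsub>H\<^esub> y = y"
proof -
  note [simp] = H.m_closed H.m_assoc
  let ?s = "star G s"
  have c: "E \<in> carrier H" "\<pi> s \<in> carrier H" "\<pi> ?s \<in> carrier H"
    using E s by (simp_all add: G.star eps_products_closed)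
  have i: "E \<otimes>\<^bsub>H\<^esub> E = E" by (rule eps_products_idem[OF E])
  have i': "E \<otimes>\<^bsub>H\<^esub> (E \<otimes>\<^bsub>H\<^esub> z) = E \<otimes>\<^bsub>H\<^esub> z" if "z \<in> carrier H" for z
    using i c that by (simp flip: H.m_assoc)
  have comm: "E \<otimes>\<^bsub>H\<^esub> eps s = eps s \<otimes>\<^bsub>H\<^esub> E" using E s by (rule eps_products_comm_eps)
  have "x \<otimes>\<^bsub>H\<^esub> y \<otimes>\<^bsub>H\<^esub> x = E \<otimes>\<^bsub>H\<^esub> (eps s \<otimes>\<^bsub>H\<^esub> E) \<otimes>\<^bsub>H\<^esub> \<pi> s"
    using c i' by (simp add: x_def y_def eps_def)
  also have "\<dots> = E \<otimes>\<^bsub>H\<^esub> (eps s \<otimes>\<^bsub>H\<^esub> \<pi> s)"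
    using c s i' by (simp flip: comm)
  finally show "x \<otimes>\<^bsub>H\<^esub> y \<otimes>\<^bsub>H\<^esub> x = x" using s by (simp only: eps_mult x_def)
  have "y \<otimes>\<^bsub>H\<^esub> x \<otimes>\<^bsub>H\<^esub> y = \<pi> ?s \<otimes>\<^bsub>H\<^esub> (E \<otimes>\<^bsub>H\<^esub> eps s) \<otimes>\<^bsub>H\<^esub> E"
    using c i' by (simp add: x_def y_def eps_def)
  also have "\<dots> = \<pi> ?s \<otimes>\<^bsub>H\<^esub> eps s \<otimes>\<^bsub>H\<^esub> E"
    using c s i by (simp add: comm)
  also have "\<pi> ?s \<otimes>\<^bsub>H\<^esub> eps s = \<pi> ?s"
    using regular_rule[of ?s] s by (simp add: eps_def G.star_star G.star)
  finally show "y \<otimes>\<^bsub>H\<^esub> x \<otimes>\<^bsub>H\<^esub> y = y" by (simp add: y_def)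
qed

lemma hom_of_idempotents: "carrier G = idempotents G \<Longrightarrow> \<pi> \<in> hom G H"
  by (rule homI) (auto simp: mult_idempotents)

end

section \<open>The universal semigroup\<close>

lemma Pr_sgrp: "sgrp (Pr G)"
  unfolding Pr_def by (rule presented_sgrp_is_sgrp)

lemma iota_closed: "g \<in> carrier G \<Longrightarrow> iota G g \<in> carrier (Pr G)"
  by (auto simp: iota_def Pr_def presented_sgrp_def nonempty_words_def intro: quotientI)

text \<open>Every element is the class of a nonempty word. Letters are added on the right because
  the normal form \<open>E \<otimes> iota G s\<close> takes up new factors there.\<close>

lemma Pr_induct [consumes 1, case_names iota mult]:
  assumes x: "x \<in> carrier (Pr G)"
    and iota: "\<And>g. g \<in> carrier G \<Longrightarrow> P (iota G g)"
    and mult: "\<And>x g. \<lbrakk>x \<in> carrier (Pr G); P x; g \<in> carrier G\<rbrakk> \<Longrightarrow> P (x \<otimes>\<^bsub>Pr G\<^esub> iota G g)"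
  shows "P x"
proof -
  let ?c = "\<lambda>u. gen_cong (carrier G) (Pr_relations G) `` {u}"
  have car: "carrier (Pr G) = ?c ` nonempty_words (carrier G)"
    by (auto simp: Pr_def presented_sgrp_def quotient_def)
  obtain u where u: "u \<noteq> []" "set u \<subseteq> carrier G" "x = ?c u"
    using x by (auto simp: car nonempty_words_def)
  have "P (?c u)" using u(1,2)
  proof (induction u rule: rev_nonempty_induct)
    case (single g) then show ?case using iota[of g] by (simp add: iota_def)
  next
    case (snoc g u)
    then have w: "u \<in> nonempty_words (carrier G)" "[g] \<in> nonempty_words (carrier G)"
      by (auto simp: nonempty_words_def)
    then have "?c (u @ [g]) = ?c u \<otimes>\<^bsub>Pr G\<^esub> iota G g"
      by (simp add: Pr_def iota_def presented_mult_class)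
    then show ?case using mult[of "?c u" g] snoc w by (simp add: car)
  qed
  then show ?thesis using u by simp
qed

context inverse_sgrp
begin

text \<open>Each law is a generating relation, once the products are written as classes of words of
  length at most three.\<close>

lemma iota_partial_hom: "iota G \<in> partial_hom G (Pr G)"
proof -
  let ?C = "gen_cong (carrier G) (Pr_relations G)"
  have word2: "iota G a \<otimes>\<^bsub>Pr G\<^esub> iota G b = ?C `` {[a, b]}"
    if "a \<in> carrier G" "b \<in> carrier G" for a b
    using that presented_mult_class[of "[a]" "carrier G" "[b]" "Pr_relations G"]
    by (simp add: Pr_def iota_def nonempty_words_def)
  have word3: "iota G a \<otimes>\<^bsub>Pr G\<^esub> iota G b \<otimes>\<^bsub>Pr G\<^esub> iota G c = ?C `` {[a, b, c]}"
    if "a \<in> carrier G" "b \<in> carrier G" "c \<in> carrier G" for a b c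
    using that presented_mult_class[of "[a, b]" "carrier G" "[c]" "Pr_relations G"]
    by (simp add: word2) (simp add: Pr_def iota_def nonempty_words_def)
  have rel: "?C `` {u} = ?C `` {v}"
    if "(u, v) \<in> Pr_relations G" "set u \<subseteq> carrier G" "set v \<subseteq> carrier G" "u \<noteq> []" "v \<noteq> []" for u v
    using that by (intro equiv_class_eq[OF equiv_gen_cong] gen_cong.rel) (auto simp: nonempty_words_def)
  show ?thesis
    unfolding partial_hom_def mem_Collect_eq
  proof (intro conjI ballI)
    show "iota G \<in> carrier G \<rightarrow> carrier (Pr G)" by (simp add: iota_closed)
    fix s t assume st: "s \<in> carrier G" "t \<in> carrier G"
    then have c: "star G s \<in> carrier G" "star G t \<in> carrier G" "s \<otimes> t \<in> carrier G"
      by (simp_all add: star m_closed)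
    show "iota G s \<otimes>\<^bsub>Pr G\<^esub> iota G t \<otimes>\<^bsub>Pr G\<^esub> iota G (star G t) = iota G (s \<otimes> t) \<otimes>\<^bsub>Pr G\<^esub> iota G (star G t)"
      using st c by (simp only: word3, simp only: word2) (rule rel, auto simp: Pr_relations_def)
    show "iota G (star G s) \<otimes>\<^bsub>Pr G\<^esub> iota G s \<otimes>\<^bsub>Pr G\<^esub> iota G t = iota G (star G s) \<otimes>\<^bsub>Pr G\<^esub> iota G (s \<otimes> t)"
      using st c by (simp only: word3, simp only: word2) (rule rel, auto simp: Pr_relations_def)
    have "([s, star G s, s], [s]) \<in> Pr_relations G" using st(1) by (auto simp: Pr_relations_def)
    then show "iota G s \<otimes>\<^bsub>Pr G\<^esub> iota G (star G s) \<otimes>\<^bsub>Pr G\<^esub> iota G s = iota G s"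
      using st c by (simp only: word3) (simp add: iota_def rel)
  qed
qed

lemma partial_homomorphism_iota: "partial_homomorphism G (Pr G) (iota G)"
  by (intro partial_homomorphism.intro partial_homomorphism_axioms.intro inverse_sgrp_axioms
      Pr_sgrp iota_partial_hom)

lemma iota_inj: "inj_on (iota G) (carrier G)"
  by (rule inj_on_inverseI) (rule degree_map(3))

lemma Pr_inverse_sgrp: "inverse_sgrp (Pr G)"
proof -
  interpret P: partial_homomorphism G "Pr G" "iota G" by (rule partial_homomorphism_iota)
  let ?d = "degree_map G"
  \<comment> \<open>A further generator \<open>t\<close> is taken up by \<open>mult_eq_eps\<close>:
    \<open>E\<close> becomes \<open>E \<otimes> eps s\<close>, and \<open>s\<close> becomes
    \<open>s \<otimes> t\<close>.\<close>
  have normal_form: "\<exists>E\<in>P.eps_products. \<exists>s\<in>carrier G. x = E \<otimes>\<^bsub>Pr G\<^esub> iota G s"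
    if "x \<in> carrier (Pr G)" for x
    using that
  proof (induction rule: Pr_induct)
    case (iota g)
    then show ?case using P.eps_mult[of g] P.eps_products.eps[of g] by metis
  next
    case (mult x t)
    then obtain E s where E: "E \<in> P.eps_products" "s \<in> carrier G" "x = E \<otimes>\<^bsub>Pr G\<^esub> iota G s" by blast
    then have "x \<otimes>\<^bsub>Pr G\<^esub> iota G t = (E \<otimes>\<^bsub>Pr G\<^esub> P.eps s) \<otimes>\<^bsub>Pr G\<^esub> iota G (s \<otimes> t)"
      using mult by (simp add: P.H.m_assoc P.mult_eq_eps P.eps_products_closed m_closed)
    then show ?case using E mult P.eps_products.intros m_closed by metis
  qed
  have degree_eps: "?d E \<in> idempotents G" if "E \<in> P.eps_products" for E
    using that P.eps_products_idem P.eps_products_closed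
    by (intro hom_idempotents[OF degree_map(2)]) (auto simp: idempotents_def)
  \<comment> \<open>For a generator, \<open>eps s\<close> ends in the image of
    \<open>star G s\<close>, which absorbs that of \<open>s \<otimes> star G s\<close> on the right.
    For a product, the factor belonging to \<open>x\<close> is moved past \<open>y\<close> by
    commutativity.\<close>
  have absorb: "E \<otimes>\<^bsub>Pr G\<^esub> iota G (?d E) = E" if "E \<in> P.eps_products" for E
    using that
  proof (induction rule: P.eps_products.induct)
    case (eps s)
    have "?d (P.eps s) = s \<otimes> star G s"
      using eps degree_map(2,3) by (simp add: P.eps_def hom_mult iota_closed star)
    then show ?case
      using eps P.mult_source[of "star G s"] by (simp add: P.eps_def P.H.m_assoc star star_star m_closed)
  next
    case (mult x y)
    note c = mult.hyps[THEN P.eps_products_closed]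
    note f = mult.hyps[THEN degree_eps]
    note f' = f[THEN idempotents_closed]
    have "iota G (?d x) \<in> P.eps_products"
      using P.eps_products.eps[OF f'(1)] f(1) by (simp add: P.eps_idempotent)
    then have comm: "iota G (?d x) \<otimes>\<^bsub>Pr G\<^esub> y = y \<otimes>\<^bsub>Pr G\<^esub> iota G (?d x)"
      using mult.hyps(2) by (rule P.eps_products_comm)
    have "x \<otimes>\<^bsub>Pr G\<^esub> y = x \<otimes>\<^bsub>Pr G\<^esub> (iota G (?d x) \<otimes>\<^bsub>Pr G\<^esub> y) \<otimes>\<^bsub>Pr G\<^esub> iota G (?d y)"
      using mult.IH c f' by (metis P.H.m_assoc P.H.m_closed P.closed)
    also have "\<dots> = x \<otimes>\<^bsub>Pr G\<^esub> y \<otimes>\<^bsub>Pr G\<^esub> (iota G (?d x) \<otimes>\<^bsub>Pr G\<^esub> iota G (?d y))"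
      unfolding comm using c f' by (simp add: P.H.m_assoc P.H.m_closed)
    also have "\<dots> = x \<otimes>\<^bsub>Pr G\<^esub> y \<otimes>\<^bsub>Pr G\<^esub> iota G (?d (x \<otimes>\<^bsub>Pr G\<^esub> y))"
      using c f by (simp add: P.mult_idempotents hom_mult[OF degree_map(2)])
    finally show ?case by simp
  qed
  \<comment> \<open>By \<open>absorb\<close>, \<open>s\<close> may be replaced by
    \<open>?d E \<otimes> s\<close>, which is the degree of \<open>x\<close> and thus idempotent.
    The image of an idempotent is its own \<open>eps\<close>, so \<open>x\<close> is a product of
    such elements.\<close>
  have idem: "x \<in> P.eps_products" if x: "x \<in> idempotents (Pr G)" for x
  proof -
    obtain E s where E: "E \<in> P.eps_products" "s \<in> carrier G" "x = E \<otimes>\<^bsub>Pr G\<^esub> iota G s"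
      using normal_form[OF idempotents_closed[OF x]] by blast
    have dE: "?d E \<in> idempotents G" by (rule degree_eps[OF E(1)])
    have x_eq: "x = E \<otimes>\<^bsub>Pr G\<^esub> iota G (?d E \<otimes> s)"
      using E absorb[OF E(1)] P.idempotent_mult[OF dE E(2)] dE
      by (metis P.H.m_assoc P.closed P.eps_products_closed idempotents_closed)
    have "?d x = ?d E \<otimes> s"
      using E degree_map(2,3) P.eps_products_closed by (simp add: hom_mult iota_closed)
    then have "?d E \<otimes> s \<in> idempotents G" using hom_idempotents[OF degree_map(2) x] by simp
    then show ?thesis
      using x_eq E(1) P.eps_idempotent P.eps_products.intros idempotents_closed by metis
  qed
  show ?thesis
  proof (rule P.H.inverse_sgrpI)
    fix x assume "x \<in> carrier (Pr G)"
    then obtain E s where E: "E \<in> P.eps_products" "s \<in> carrier G" "x = E \<otimes>\<^bsub>Pr G\<^esub> iota G s"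
      using normal_form by blast
    then show "\<exists>y\<in>carrier (Pr G). x \<otimes>\<^bsub>Pr G\<^esub> y \<otimes>\<^bsub>Pr G\<^esub> x = x \<and> y \<otimes>\<^bsub>Pr G\<^esub> x \<otimes>\<^bsub>Pr G\<^esub> y = y"
      using P.normal_form_inverse[OF E(1,2)] P.eps_products_closed
      by (intro bexI[of _ "iota G (star G s) \<otimes>\<^bsub>Pr G\<^esub> E"]) (auto intro!: P.H.m_closed simp: star)
  next
    show "e \<otimes>\<^bsub>Pr G\<^esub> f = f \<otimes>\<^bsub>Pr G\<^esub> e" if "e \<in> idempotents (Pr G)" "f \<in> idempotents (Pr G)" for e f
      using that idem P.eps_products_comm by blast
  qed
qed

section \<open>When the canonical map is a homomorphism or surjective\<close>

lemma iota_hom_imp_idempotents: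
  assumes hom: "iota G \<in> hom G (Pr G)"
  shows "carrier G = idempotents G"
proof -
  let ?B = "\<lparr>carrier = UNIV, mult = (\<and>), one = True\<rparr>"
  have B: "sgrp ?B" by standard auto
  have "s \<in> idempotents G" if s: "s \<in> carrier G" for s
  proof -
    note [simp] = m_closed m_assoc
    define f where "f = star G s \<otimes> s"
    have f: "f \<in> idempotents G" unfolding f_def by (rule source_idempotent[OF s])
    have fc: "f \<in> carrier G" using f by (rule idempotents_closed)
    \<comment> \<open>This is \<open>f \<le> t\<close> in the natural order, as \<open>f\<close> is
      its own source idempotent.\<close>
    define \<pi> where "\<pi> t = (t \<otimes> f = f)" for t
    have \<pi>_left: "f \<otimes> star G t = f" if "t \<in> carrier G" "\<pi> t" for t
      using that star_mult[of t f] fc f by (simp add: \<pi>_def star_idempotent)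
    \<comment> \<open>First \<open>star G t \<otimes> f = f \<otimes> t\<close>, since each passes
      through a product of \<open>f\<close> and the source idempotent of \<open>t\<close>.
      Multiplying by \<open>t\<close> on the left then shows that both are \<open>f\<close>.\<close>
    have \<pi>_star_imp: "\<pi> (star G t)" if t: "t \<in> carrier G" "\<pi> t" for t
    proof -
      have tf: "t \<otimes> f = f" using t(2) by (simp only: \<pi>_def)
      have c: "star G t \<in> carrier G" using t(1) by (rule star)
      have "star G t \<otimes> f = (star G t \<otimes> t) \<otimes> f" using t(1) c fc tf by simp
      also have "\<dots> = f \<otimes> (star G t \<otimes> t)"
        by (rule idempotents_comm[OF source_idempotent[OF t(1)] f])
      also have "\<dots> = f \<otimes> t" using \<pi>_left[OF t] t(1) c fc by (simp flip: m_assoc)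
      finally have g: "star G t \<otimes> f = f \<otimes> t" .
      have "f = (t \<otimes> star G t \<otimes> t) \<otimes> f" using tf star(2)[OF t(1)] by simp
      also have "\<dots> = t \<otimes> (f \<otimes> t)" using t(1) c fc tf g by simp
      also have "\<dots> = f \<otimes> t" using t(1) fc tf by (simp flip: m_assoc)
      finally show ?thesis using g by (simp add: \<pi>_def)
    qed
    have \<pi>_star: "\<pi> (star G t) = \<pi> t" if "t \<in> carrier G" for t
      using \<pi>_star_imp[of t] \<pi>_star_imp[of "star G t"] that by (auto simp: star star_star)
    have \<pi>_comm: "f \<otimes> t = f" if "t \<in> carrier G" "\<pi> t" for t
      using \<pi>_left[of "star G t"] that \<pi>_star by (simp add: star star_star)
    have right: "\<pi> (a \<otimes> t) = \<pi> a" if "a \<in> carrier G" "t \<in> carrier G" "\<pi> t" for a t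
      using that fc by (simp add: \<pi>_def)
    have \<pi>_iff: "\<pi> t \<longleftrightarrow> f \<otimes> t = f" if t: "t \<in> carrier G" for t
    proof
      assume "f \<otimes> t = f"
      then have "star G t \<otimes> f = f" using star_mult[of f t] t fc f by (simp add: star_idempotent)
      then show "\<pi> t" using \<pi>_star[OF t] by (simp add: \<pi>_def)
    qed (use \<pi>_comm[OF t] in simp)
    have left: "\<pi> (a \<otimes> t) = \<pi> t" if "a \<in> carrier G" "t \<in> carrier G" "\<pi> a" for a t
      using that fc \<pi>_comm[of a] by (simp add: \<pi>_iff flip: m_assoc)
    \<comment> \<open>In the first two kinds of relation a factor common to both sides, up to
      \<open>star\<close>, decides: if it is false, so are both sides; if it is true,
      \<open>right\<close> or \<open>left\<close> removes the element from the product.\<close>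
    have eq: "word_prod ?B (map \<pi> u) = word_prod ?B (map \<pi> v)"
      if "(u, v) \<in> Pr_relations G" for u v
      using that unfolding Pr_relations_def
      by (elim UnE CollectE exE conjE) (auto simp: \<pi>_star left right)
    obtain d where d: "d \<in> hom (Pr G) ?B" "\<And>t. t \<in> carrier G \<Longrightarrow> d (iota G t) = \<pi> t"
      using ex1_implies_ex[OF presented_sgrp_universal[OF B, of \<pi> "carrier G" "Pr_relations G"]] eq
      unfolding Pr_def iota_def by auto
    have c: "star G s \<in> carrier G" using s by (rule star)
    \<comment> \<open>The induced map \<open>d\<close> is evaluated on the image of
      \<open>f\<close>, which splits because \<open>iota G\<close> is assumed to be a homomorphism.
      As \<open>\<pi> f\<close> holds, so does \<open>\<pi> s\<close>; moreover
      \<open>s \<otimes> f = s\<close>, whence \<open>s = f\<close>.\<close>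
    have "\<pi> (star G s \<otimes> s) = d (iota G (star G s) \<otimes>\<^bsub>Pr G\<^esub> iota G s)"
      using s c by (simp add: d(2) flip: hom_mult[OF hom])
    also have "\<dots> = (\<pi> (star G s) \<and> \<pi> s)"
      using s c by (simp add: d(2) iota_closed hom_mult[OF d(1)])
    finally have "\<pi> (star G s \<otimes> s) = (\<pi> (star G s) \<and> \<pi> s)" .
    moreover have "\<pi> (star G s \<otimes> s)" using idempotents_idem[OF f] by (simp add: \<pi>_def f_def)
    ultimately have "s \<otimes> f = f" by (simp add: \<pi>_def)
    then show ?thesis using f star[OF s] s by (simp add: f_def)
  qed
  then show ?thesis by (intro equalityI subsetI) (blast, rule idempotents_closed)
qed

text \<open>Closure puts the product of two generators at some generator \<open>u\<close>, and the
  degree map identifies \<open>u\<close> as \<open>s \<otimes> t\<close>.\<close>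

lemma inverse_subsemigroup_imp_hom:
  assumes sub: "inverse_subsemigroup (iota G ` carrier G) (Pr G)"
  shows "iota G \<in> hom G (Pr G)"
proof (rule homI)
  show "iota G x \<in> carrier (Pr G)" if "x \<in> carrier G" for x using that by (rule iota_closed)
  fix s t assume st: "s \<in> carrier G" "t \<in> carrier G"
  then obtain u where u: "u \<in> carrier G" "iota G s \<otimes>\<^bsub>Pr G\<^esub> iota G t = iota G u"
    using sub unfolding inverse_subsemigroup_def by blast
  have "u = degree_map G (iota G s \<otimes>\<^bsub>Pr G\<^esub> iota G t)" using u by (simp add: degree_map(3))
  also have "\<dots> = s \<otimes> t" using st by (simp add: hom_mult[OF degree_map(2)] degree_map(3) iota_closed)
  finally have "u = s \<otimes> t" .
  then show "iota G (s \<otimes> t) = iota G s \<otimes>\<^bsub>Pr G\<^esub> iota G t" using u by simp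
qed

text \<open>A multiplicative \<open>iota G\<close> collapses every word to a single letter.\<close>

lemma iota_hom_imp_surj:
  assumes hom: "iota G \<in> hom G (Pr G)"
  shows "iota G ` carrier G = carrier (Pr G)"
proof
  show "iota G ` carrier G \<subseteq> carrier (Pr G)" by (intro image_subsetI iota_closed)
  show "carrier (Pr G) \<subseteq> iota G ` carrier G"
  proof
    fix x assume "x \<in> carrier (Pr G)"
    then show "x \<in> iota G ` carrier G"
    proof (induction rule: Pr_induct)
      case (mult x g)
      then obtain h where "h \<in> carrier G" "x = iota G h" by blast
      then have "x \<otimes>\<^bsub>Pr G\<^esub> iota G g = iota G (h \<otimes> g)" using \<open>g \<in> carrier G\<close> by (simp add: hom_mult[OF hom])
      then show ?case using \<open>h \<in> carrier G\<close> \<open>g \<in> carrier G\<close> m_closed by blast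
    qed blast
  qed
qed

lemma inverse_subsemigroup_iff_surj:
  "inverse_subsemigroup (iota G ` carrier G) (Pr G) \<longleftrightarrow> iota G ` carrier G = carrier (Pr G)"
proof -
  interpret P: inverse_sgrp "Pr G" by (rule Pr_inverse_sgrp)
  show ?thesis
    using iota_hom_imp_surj[OF inverse_subsemigroup_imp_hom] P.m_closed P.star
    by (auto simp: inverse_subsemigroup_def iota_closed)
qed

lemma semilattice_sgrp_if_Pr: "semilattice_sgrp (Pr G) \<Longrightarrow> semilattice_sgrp G"
proof (erule semilattice_sgrp_epi[OF _ inverse_sgrp_axioms degree_map(2)])
  show "degree_map G ` carrier (Pr G) = carrier G"
    using degree_map(3) iota_closed hom_in_carrier[OF degree_map(2)] by force
qed

end

section \<open>The iterated construction\<close>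

lemma iterated_Pr_inverse_sgrp: "inverse_sgrp G \<Longrightarrow> inverse_sgrp (iterated_Pr G n)"
proof (induction n)
  case 0 then show ?case by (simp add: image_group_inverse_sgrp inj_on_def)
next
  case (Suc n)
  then show ?case
    by (simp add: image_group_inverse_sgrp inverse_sgrp.Pr_inverse_sgrp encode_inj)
qed

text \<open>The inverse of \<open>f\<close> is a surjective homomorphism onto \<open>S\<close>. This
  serves to strip the encodings \<open>Gen\<close> and \<open>encode\<close> off the
  iterates.\<close>

lemma semilattice_sgrp_if_iso:
  assumes "inverse_sgrp S" "f \<in> iso S T" "semilattice_sgrp T"
  shows "semilattice_sgrp S"
proof -
  have f: "f \<in> hom S T" "inj_on f (carrier S)" "f ` carrier S = carrier T"
    using assms(2) by (auto simp: iso_def bij_betw_def)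
  interpret S: inverse_sgrp S by fact
  show ?thesis
  proof (rule semilattice_sgrp_epi[OF assms(3,1)])
    show "inv_into (carrier S) f \<in> hom T S"
    proof (rule homI)
      fix x y assume "x \<in> carrier T" "y \<in> carrier T"
      then obtain a b where "a \<in> carrier S" "x = f a" "b \<in> carrier S" "y = f b" using f(3) by blast
      then show "inv_into (carrier S) f (x \<otimes>\<^bsub>T\<^esub> y) =
          inv_into (carrier S) f x \<otimes>\<^bsub>S\<^esub> inv_into (carrier S) f y"
        using f(2) by (simp add: S.m_closed flip: hom_mult[OF f(1)])
    qed (metis f(3) inv_into_into)
    show "inv_into (carrier S) f ` carrier T = carrier S"
      using f by (metis inv_into_image_cancel order_refl)
  qed
qed

lemma semilattice_sgrp_if_iterated_Pr:
  assumes G: "inverse_sgrp G"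
  shows "semilattice_sgrp (iterated_Pr G n) \<Longrightarrow> semilattice_sgrp G"
proof (induction n)
  case 0
  then show ?case
    using semilattice_sgrp_if_iso[OF G iterated_Pr_0_iso] G inverse_sgrp.axioms(1) by blast
next
  case (Suc n)
  interpret S: inverse_sgrp "iterated_Pr G n" by (rule iterated_Pr_inverse_sgrp[OF G])
  show ?case
    using Suc.IH S.semilattice_sgrp_if_Pr
      semilattice_sgrp_if_iso[OF S.Pr_inverse_sgrp iterated_Pr_Suc_iso Suc.prems] by blast
qed

theorem proposition5p11:
  fixes G :: "('a, 'm) monoid_scheme"
  assumes "inverse_sgrp G"
  shows
    \<comment> \<open>(i) and (ii); the type of \<open>Pr G\<close> suffices to test (i), which then holds for every type \<open>'b\<close>\<close>
    "(partial_homs_are_homs TYPE('a list set) G \<longleftrightarrow> iota G \<in> hom G (Pr G)) \<and>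
     (iota G \<in> hom G (Pr G) \<longrightarrow> partial_homs_are_homs TYPE('b) G) \<and>
     \<comment> \<open>(ii) and (iii)\<close>
     (iota G \<in> hom G (Pr G) \<longleftrightarrow> inverse_subsemigroup (iota G ` carrier G) (Pr G)) \<and>
     (inverse_subsemigroup (iota G ` carrier G) (Pr G) \<longrightarrow> iota G ` carrier G = carrier (Pr G)) \<and>
     \<comment> \<open>(iii) and (iv)\<close>
     (inverse_subsemigroup (iota G ` carrier G) (Pr G) \<longleftrightarrow> iota G \<in> iso G (Pr G)) \<and>
     (iota G \<in> iso G (Pr G) \<longrightarrow>
        (\<forall>x\<in>carrier (Pr G). inv_into (carrier G) (iota G) x = degree_map G x)) \<and>
     \<comment> \<open>(iv) and (v)\<close>
     (iota G \<in> iso G (Pr G) \<longleftrightarrow> carrier G = idempotents G) \<and>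
     (carrier G = idempotents G \<longleftrightarrow> semilattice_sgrp G) \<and>
     (\<not> semilattice_sgrp G \<longrightarrow>
        (\<exists>(H :: 'a list set monoid) \<pi>. sgrp H \<and> \<pi> \<in> partial_hom G H \<and> \<pi> \<notin> hom G H)) \<and>
     (\<not> semilattice_sgrp G \<longrightarrow>
        (\<forall>n. inj_on (iterated_iota G n) (carrier (iterated_Pr G n)) \<and>
             iterated_iota G n ` carrier (iterated_Pr G n) \<subset> carrier (iterated_Pr G (Suc n))))"
proof -
  interpret inverse_sgrp G by (fact assms)
  have hom_idem: "iota G \<in> hom G (Pr G) \<longleftrightarrow> carrier G = idempotents G"
    using iota_hom_imp_idempotents
      partial_homomorphism.hom_of_idempotents[OF partial_homomorphism_iota] by blast
  \<comment> \<open>The type \<open>'c\<close> is generalized, so that the fact applies to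
    \<open>'a list set\<close> as well as to \<open>'b\<close>.\<close>
  have all_homs: "partial_homs_are_homs TYPE('c) G" if "carrier G = idempotents G"
    unfolding partial_homs_are_homs_def
  proof (intro allI impI subsetI)
    fix H :: "'c monoid" and \<pi> assume "sgrp H" "\<pi> \<in> partial_hom G H"
    then have "partial_homomorphism G H \<pi>"
      by (intro partial_homomorphism.intro partial_homomorphism_axioms.intro inverse_sgrp_axioms)
    then show "\<pi> \<in> hom G H" using that by (rule partial_homomorphism.hom_of_idempotents)
  qed
  \<comment> \<open>The universal target \<open>Pr G\<close> lives in this type, so
    \<open>iota G\<close> is itself a test case.\<close>
  have homs_imp: "iota G \<in> hom G (Pr G)" if "partial_homs_are_homs TYPE('a list set) G"
    using that Pr_sgrp iota_partial_hom unfolding partial_homs_are_homs_def by blast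
  have sub_hom: "inverse_subsemigroup (iota G ` carrier G) (Pr G) \<longleftrightarrow> iota G \<in> hom G (Pr G)"
    using inverse_subsemigroup_iff_surj inverse_subsemigroup_imp_hom iota_hom_imp_surj by blast
  have iso_hom: "iota G \<in> iso G (Pr G) \<longleftrightarrow> iota G \<in> hom G (Pr G)"
    using iota_hom_imp_surj iota_inj by (auto simp: iso_def bij_betw_def)
  have inv_degree: "inv_into (carrier G) (iota G) x = degree_map G x"
    if "iota G \<in> iso G (Pr G)" "x \<in> carrier (Pr G)" for x
  proof -
    have "x \<in> iota G ` carrier G" using that by (simp add: iso_hom iota_hom_imp_surj)
    then obtain g where "g \<in> carrier G" "x = iota G g" by (rule imageE)
    then show ?thesis by (simp add: iota_inj degree_map(3))
  qed
  have chain: "inj_on (iterated_iota G n) (carrier (iterated_Pr G n)) \<and>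
      iterated_iota G n ` carrier (iterated_Pr G n) \<subset> carrier (iterated_Pr G (Suc n))"
    if "\<not> semilattice_sgrp G" for n
  proof -
    let ?S = "iterated_Pr G n"
    interpret S: inverse_sgrp ?S by (rule iterated_Pr_inverse_sgrp[OF assms])
    have "\<not> semilattice_sgrp ?S" using semilattice_sgrp_if_iterated_Pr[OF assms] that by blast
    \<comment> \<open>Surjectivity at this stage would make the canonical map a homomorphism and
      hence the stage a semilattice.\<close>
    then have "iota ?S ` carrier ?S \<noteq> carrier (Pr ?S)"
      using S.inverse_subsemigroup_iff_surj S.inverse_subsemigroup_imp_hom
        S.iota_hom_imp_idempotents S.semilattice_iff_idempotents by blast
    then have sub: "iota ?S ` carrier ?S \<subset> carrier (Pr ?S)"
      by (intro psubsetI image_subsetI iota_closed)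
    have eq: "iterated_iota G n = encode \<circ> iota ?S" by (auto simp: iterated_iota_def)
    have car: "carrier (iterated_Pr G (Suc n)) = encode ` carrier (Pr ?S)"
      by (simp add: image_group_def)
    have "inj_on (iterated_iota G n) (carrier ?S)"
      unfolding eq using sub
      by (intro comp_inj_on[OF S.iota_inj] inj_on_subset[OF encode_inj]) blast
    moreover have "iterated_iota G n ` carrier ?S \<subset> carrier (iterated_Pr G (Suc n))"
      \<comment> \<open>Strictness survives the encoding because \<open>encode\<close> is injective
        on all of \<open>Pr ?S\<close>.\<close>
      unfolding eq car image_comp[symmetric] by (rule image_strict_mono[OF encode_inj sub])
    ultimately show ?thesis by blast
  qed
  have counterexample: "\<exists>(H :: 'a list set monoid) \<pi>. sgrp H \<and> \<pi> \<in> partial_hom G H \<and> \<pi> \<notin> hom G H"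
    if "\<not> semilattice_sgrp G"
    using that hom_idem semilattice_iff_idempotents Pr_sgrp iota_partial_hom by blast
  show ?thesis
  proof (intro conjI impI allI ballI)
    show "partial_homs_are_homs TYPE('a list set) G \<longleftrightarrow> iota G \<in> hom G (Pr G)"
      using homs_imp all_homs hom_idem by blast
    show "partial_homs_are_homs TYPE('b) G" if "iota G \<in> hom G (Pr G)"
      using that all_homs hom_idem by blast
    show "iota G ` carrier G = carrier (Pr G)" if "inverse_subsemigroup (iota G ` carrier G) (Pr G)"
      using that inverse_subsemigroup_iff_surj by blast
    show "iota G \<in> hom G (Pr G) \<longleftrightarrow> inverse_subsemigroup (iota G ` carrier G) (Pr G)"
      "inverse_subsemigroup (iota G ` carrier G) (Pr G) \<longleftrightarrow> iota G \<in> iso G (Pr G)"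
      "iota G \<in> iso G (Pr G) \<longleftrightarrow> carrier G = idempotents G"
      using sub_hom iso_hom hom_idem by simp_all
    show "carrier G = idempotents G \<longleftrightarrow> semilattice_sgrp G"
      by (rule semilattice_iff_idempotents[symmetric])
  qed (fact inv_degree counterexample chain[THEN conjunct1] chain[THEN conjunct2])+
qed

end
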